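(* Let $\mathbb{K}$ be a field. A matrix $A\in M_n(\mathbb{K})\setminus\{0\}$ has a Frobenius decomposition if and only if it is semisimple. If this is the case, the Frobenius decomposition and, so, the Frobenius covariants of $A$ are uniquely determined.
   Context: $\overline{\mathbb{K}}$ is the algebraic closure of $\mathbb{K}$. A matrix in $M_n(\mathbb{K})$ is semisimple if it is diagonalizable over $\overline{\mathbb{K}}$. A non-empty family of matrices $A_1,\dots,A_p\in M_n(\overline{\mathbb{K}})\setminus\{0\}$ is a Frobenius system if $A_iA_j=\delta_{ij}A_i$ for every $i,j$. A Frobenius decomposition of $A\in M_n(\mathbb{K})$ is any decomposition $A=\sum_{i=1}^p\lambda_iA_i$ where $A_1,\dots,A_p\in M_n(\overline{\mathbb{K}})\setminus\{0\}$ form a Frobenius system and $\lambda_1,\dots,\lambda_p\in\overline{\mathbb{K}}\setminus\{0\}$ are pairwise distinct; in this case $A_1,\dots,A_p$ are called Frobenius covariants of $A$. Uniqueness is understood up to the order of the summands. *)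

theory Defs
  imports "HOL-Analysis.Analysis" "HOL-Algebra.Algebraic_Closure_Type"
begin

text \<open>
  \<open>M\<^sub>n(K)\<close> is the type \<open>'k^'n^'n\<close> with \<open>'k :: field\<close> and \<open>n = CARD('n)\<close>.  The algebraic closure of
  \<open>K\<close> is \<open>'k alg_closure\<close>, and a matrix over \<open>K\<close> is regarded as a matrix over the closure through
  the entrywise embedding \<open>map_matrix to_ac\<close>.
\<close>

definition diagonal_matrix :: "'a::zero^'n^'n \<Rightarrow> bool" where
  "diagonal_matrix D \<longleftrightarrow> (\<forall>i j. i \<noteq> j \<longrightarrow> D $ i $ j = 0)"

definition diagonalizable_matrix :: "'a::field^'n^'n \<Rightarrow> bool" where
  "diagonalizable_matrix A \<longleftrightarrow>
     (\<exists>(P :: 'a^'n^'n) (D :: 'a^'n^'n). invertible P \<and> diagonal_matrix D \<and> A = P ** D ** matrix_inv P)"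

definition semisimple_matrix :: "'k::field^'n^'n \<Rightarrow> bool" where
  "semisimple_matrix A \<longleftrightarrow> diagonalizable_matrix (map_matrix to_ac A)"

text \<open>
  The library's \<open>*s\<close> multiplies a vector by a scalar of its entry type, so on matrices (vectors of
  rows) it is not multiplication by a field element.
\<close>

definition smult_matrix :: "'a::times \<Rightarrow> 'a^'n^'m \<Rightarrow> 'a^'n^'m" where
  "smult_matrix c A = map_matrix (\<lambda>x. c * x) A"

text \<open>
  Families \<open>E\<^sub>1, \<dots>, E\<^sub>p\<close> are functions on \<open>nat\<close> of which only the values on \<open>{1..p}\<close> matter.
\<close>

definition frobenius_system :: "nat \<Rightarrow> (nat \<Rightarrow> 'a::field^'n^'n) \<Rightarrow> bool" where
  "frobenius_system p E \<longleftrightarrow>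
     1 \<le> p \<and>
     (\<forall>i\<in>{1..p}. E i \<noteq> 0) \<and>
     (\<forall>i\<in>{1..p}. \<forall>j\<in>{1..p}. E i ** E j = (if i = j then E i else 0))"

definition frobenius_decomposition ::
  "'k::field^'n^'n \<Rightarrow> nat \<Rightarrow> (nat \<Rightarrow> 'k alg_closure) \<Rightarrow> (nat \<Rightarrow> 'k alg_closure^'n^'n) \<Rightarrow> bool" where
  "frobenius_decomposition A p l E \<longleftrightarrow>
     frobenius_system p E \<and>
     (\<forall>i\<in>{1..p}. l i \<noteq> 0) \<and>
     inj_on l {1..p} \<and>
     map_matrix to_ac A = (\<Sum>i=1..p. smult_matrix (l i) (E i))"

text \<open>The unordered family of covariants; a Frobenius system has no repeated members.\<close>

definition frobenius_covariants :: "'k::field^'n^'n \<Rightarrow> ('k alg_closure^'n^'n) set \<Rightarrow> bool" where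
  "frobenius_covariants A C \<longleftrightarrow> (\<exists>p l E. frobenius_decomposition A p l E \<and> C = E ` {1..p})"

end

theory Submission
  imports Defs
begin

text \<open>
  The idea behind both halves is that a Frobenius system multiplies like a family of orthogonal
  projections, so that \<open>M = \<Sum>i l\<^sub>i E\<^sub>i\<close> satisfies \<open>M E\<^sub>i = l\<^sub>i E\<^sub>i = E\<^sub>i M\<close>: the nonzero columns of \<open>E\<^sub>i\<close>
  are eigenvectors of \<open>M\<close> for \<open>l\<^sub>i\<close>.

  \<^emph>\<open>Existence.\<close>  If \<open>M\<close> has a decomposition, every vector \<open>v\<close> is the sum of the vectors \<open>E\<^sub>i v\<close> and of
  the remainder \<open>v - \<Sum>i E\<^sub>i v\<close>, which \<open>M\<close> kills.  The eigenvectors of \<open>M\<close> therefore span the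
  space, and a basis chosen among them diagonalizes \<open>M\<close>
  (\<open>diagonalizable_if_eigenvectors_span\<close>, \<open>spectral_sum_diagonalizable\<close>).  Conversely, if \<open>M = P D P\<^sup>-\<^sup>1\<close> is nonzero with \<open>D\<close> diagonal,
  group the diagonal entries of \<open>D\<close> by their value: for each nonzero value \<open>c\<close>, the diagonal
  0-1 matrix marking the positions of \<open>c\<close>, conjugated by \<open>P\<close>, is a covariant.  Positions with value
  \<open>0\<close> are left out, and some position remains because \<open>M\<close> is nonzero
  (\<open>frobenius_system_if_diagonalizable\<close>).

  \<^emph>\<open>Uniqueness.\<close>  Let \<open>M = \<Sum>i l\<^sub>i E\<^sub>i = \<Sum>j m\<^sub>j F\<^sub>j\<close>.  Evaluating \<open>F\<^sub>j M E\<^sub>i\<close> in both ways gives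
  \<open>l\<^sub>i F\<^sub>j E\<^sub>i = m\<^sub>j F\<^sub>j E\<^sub>i\<close>, so \<open>F\<^sub>j E\<^sub>i = 0\<close> unless \<open>l\<^sub>i = m\<^sub>j\<close>.  Hence in
  \<open>l\<^sub>i E\<^sub>i = M E\<^sub>i = \<Sum>j m\<^sub>j F\<^sub>j E\<^sub>i\<close> at most one summand survives, and one must, since the left side is
  nonzero.  This gives \<open>j\<close> with \<open>m\<^sub>j = l\<^sub>i\<close> and \<open>E\<^sub>i = F\<^sub>j E\<^sub>i\<close>, and the mirror image of the same
  computation, on \<open>F\<^sub>j M\<close>, gives \<open>F\<^sub>j = F\<^sub>j E\<^sub>i\<close>.  So \<open>E\<^sub>i = F\<^sub>j\<close> (\<open>spectral_sums_match\<close>).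
\<close>

section \<open>Matrix algebra over a field\<close>

lemma matrix_mult_zero_left [simp]: "(0 :: 'a::semiring_1^'n^'m) ** (A :: 'a^'k^'n) = 0"
  by (simp add: matrix_matrix_mult_def vec_eq_iff)

lemma matrix_mult_zero_right [simp]: "(A :: 'a::semiring_1^'n^'m) ** (0 :: 'a^'k^'n) = 0"
  by (simp add: matrix_matrix_mult_def vec_eq_iff)

lemma sum_matrix_mult: "(\<Sum>i\<in>S. f i) ** (B :: 'a::semiring_1^'k^'n) = (\<Sum>i\<in>S. (f i :: 'a^'n^'m) ** B)"
  by (induction S rule: infinite_finite_induct)
    (simp_all, simp add: matrix_matrix_mult_def vec_eq_iff distrib_right sum.distrib)

lemma matrix_mult_sum_right: "(B :: 'a::semiring_1^'n^'m) ** (\<Sum>i\<in>S. f i) = (\<Sum>i\<in>S. B ** (f i :: 'a^'k^'n))"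
  by (induction S rule: infinite_finite_induct)
    (simp_all add: matrix_add_ldistrib)

lemma sum_matrix_vector_mult:
  "(\<Sum>i\<in>S. f i) *v (x :: 'a::semiring_1^'n) = (\<Sum>i\<in>S. (f i :: 'a^'n^'m) *v x)"
  by (induction S rule: infinite_finite_induct) (simp_all add: matrix_vector_mult_add_rdistrib)

lemma smult_matrix_mult_left:
  "smult_matrix c (A :: 'a::comm_semiring_1^'n^'m) ** (B :: 'a^'k^'n) = smult_matrix c (A ** B)"
  by (simp add: smult_matrix_def matrix_matrix_mult_def vec_eq_iff sum_distrib_left mult.assoc)

lemma smult_matrix_mult_right:
  "(A :: 'a::comm_semiring_1^'n^'m) ** smult_matrix c (B :: 'a^'k^'n) = smult_matrix c (A ** B)"
  by (simp add: smult_matrix_def matrix_matrix_mult_def vec_eq_iff sum_distrib_left mult.left_commute)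

lemma smult_matrix_vector_mult:
  "smult_matrix c (A :: 'a::comm_semiring_1^'n^'m) *v x = c *s (A *v x)"
  by (simp add: smult_matrix_def matrix_vector_mult_def vec_eq_iff sum_distrib_left mult.assoc)

lemma smult_matrix_zero_right [simp]: "smult_matrix c (0 :: 'a::mult_zero^'n^'m) = 0"
  by (simp add: smult_matrix_def vec_eq_iff)

lemma smult_matrix_cancel_scalar:
  fixes A :: "'a::idom^'n^'m"
  assumes "smult_matrix c A = smult_matrix d A" "A \<noteq> 0"
  shows "c = d"
  using assms by (auto simp: smult_matrix_def vec_eq_iff)

lemma smult_matrix_cancel_matrix:
  fixes A :: "'a::idom^'n^'m"
  assumes "smult_matrix c A = smult_matrix c B" "c \<noteq> 0"
  shows "A = B"
  using assms by (auto simp: smult_matrix_def vec_eq_iff)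

lemma matrix_inv_inverse:
  fixes P :: "'a::semiring_1^'n^'m"
  assumes "invertible P"
  shows "P ** matrix_inv P = mat 1" "matrix_inv P ** P = mat 1"
proof -
  have "P ** matrix_inv P = mat 1 \<and> matrix_inv P ** P = mat 1"
    unfolding matrix_inv_def by (rule someI_ex) (use assms in \<open>simp add: invertible_def\<close>)
  then show "P ** matrix_inv P = mat 1" "matrix_inv P ** P = mat 1" by auto
qed

section \<open>Bases of eigenvectors\<close>

text \<open>
  Choose a basis inside the spanning set of eigenvectors and let it be the columns of \<open>P\<close>.  The
  eigenvector equations for the columns say exactly that \<open>M P = P D\<close>, where \<open>D\<close> carries the
  eigenvalues.
\<close>

lemma diagonalizable_if_eigenvectors_span:
  fixes M :: "'a::field^'n^'n"
  assumes "vec.span {v. \<exists>c. M *v v = c *s v} = UNIV"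
  shows "diagonalizable_matrix M"
proof -
  let ?V = "{v. \<exists>c. M *v v = c *s v}"
  obtain B where B: "B \<subseteq> ?V" "vec.independent B" "?V \<subseteq> vec.span B"
    by (rule vec.maximal_independent_subset)
  have spanB: "vec.span B = UNIV"
    using vec.span_minimal[OF B(3) vec.subspace_span] unfolding assms by blast
  have "card B = vec.dim (UNIV :: ('a^'n) set)"
    by (rule vec.basis_card_eq_dim) (use spanB B(2) in auto)
  then have "card B = CARD('n)" by (simp only: vec_dim_card)
  moreover have "finite B" using B(2) by (rule vec.finiteI_independent)
  ultimately obtain b where b: "bij_betw b (UNIV :: 'n set) B"
    using finite_same_card_bij[of "UNIV :: 'n set" B] by auto
  have "\<forall>j. \<exists>c. M *v b j = c *s b j"
  proof
    fix j
    have "b j \<in> ?V" using bij_betwE[OF b] B(1) by blast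
    then show "\<exists>c. M *v b j = c *s b j" by simp
  qed
  then obtain c where c: "\<And>j. M *v b j = c j *s b j" by metis
  define P :: "'a^'n^'n" where "P = (\<chi> i j. b j $ i)"
  define D :: "'a^'n^'n" where "D = (\<chi> i j. if i = j then c i else 0)"
  have "columns P = B"
    using b by (auto simp: columns_def column_def P_def vec_lambda_eta bij_betw_def)
  then have inv: "invertible P"
    using spanB matrix_right_invertible_span_columns[of P] by (simp add: invertible_right_inverse)
  have "(M ** P) $ i $ j = (P ** D) $ i $ j" for i j
  proof -
    have "(M ** P) $ i $ j = (M *v b j) $ i"
      by (simp add: matrix_matrix_mult_def matrix_vector_mult_def P_def)
    also have "\<dots> = (P ** D) $ i $ j"
      by (simp add: c matrix_matrix_mult_def P_def D_def if_distrib cong: if_cong)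
    finally show ?thesis .
  qed
  then have "M ** P = P ** D" by (simp add: vec_eq_iff)
  then have "P ** D ** matrix_inv P = M ** (P ** matrix_inv P)"
    by (simp add: matrix_mul_assoc)
  then have "M = P ** D ** matrix_inv P"
    by (simp add: matrix_inv_inverse[OF inv])
  moreover have "diagonal_matrix D" by (simp add: diagonal_matrix_def D_def)
  ultimately show ?thesis using inv unfolding diagonalizable_matrix_def by blast
qed

section \<open>Linear combinations of a Frobenius system\<close>

lemma spectral_sum_mult_idempotent:
  fixes E :: "nat \<Rightarrow> 'a::field^'n^'n"
  assumes "frobenius_system p E" "j \<in> {1..p}"
  shows "(\<Sum>i=1..p. smult_matrix (l i) (E i)) ** E j = smult_matrix (l j) (E j)"
proof -
  have "(\<Sum>i=1..p. smult_matrix (l i) (E i)) ** E j = (\<Sum>i=1..p. smult_matrix (l i) (E i ** E j))"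
    by (simp add: sum_matrix_mult smult_matrix_mult_left)
  also have "\<dots> = (\<Sum>i=1..p. if i = j then smult_matrix (l j) (E j) else 0)"
    using assms by (intro sum.cong) (auto simp: frobenius_system_def)
  finally show ?thesis using assms(2) by simp
qed

lemma idempotent_mult_spectral_sum:
  fixes E :: "nat \<Rightarrow> 'a::field^'n^'n"
  assumes "frobenius_system p E" "j \<in> {1..p}"
  shows "E j ** (\<Sum>i=1..p. smult_matrix (l i) (E i)) = smult_matrix (l j) (E j)"
proof -
  have "E j ** (\<Sum>i=1..p. smult_matrix (l i) (E i)) = (\<Sum>i=1..p. smult_matrix (l i) (E j ** E i))"
    by (simp add: matrix_mult_sum_right smult_matrix_mult_right)
  also have "\<dots> = (\<Sum>i=1..p. if i = j then smult_matrix (l j) (E j) else 0)"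
    using assms by (intro sum.cong) (auto simp: frobenius_system_def)
  finally show ?thesis using assms(2) by simp
qed

text \<open>
  The system need not sum to the identity, so the decomposition of a vector into its images under
  the idempotents leaves a remainder; that remainder lies in the kernel of the sum, so it
  satisfies the eigenvector equation for the scalar \<open>0\<close>.
\<close>

lemma spectral_sum_diagonalizable:
  fixes E :: "nat \<Rightarrow> 'a::field^'n^'n"
  assumes "frobenius_system p E" and M: "M = (\<Sum>i=1..p. smult_matrix (l i) (E i))"
  shows "diagonalizable_matrix M"
proof (rule diagonalizable_if_eigenvectors_span)
  let ?V = "{v. \<exists>c. M *v v = c *s v}"
  have eig: "M *v (E i *v v) = l i *s (E i *v v)" if "i \<in> {1..p}" for i v
    using spectral_sum_mult_idempotent[OF assms(1) that, of l]
    by (simp add: M matrix_vector_mul_assoc smult_matrix_vector_mult)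
  have "v \<in> vec.span ?V" for v
  proof -
    let ?w = "\<Sum>i=1..p. E i *v v"
    have "M *v ?w = (\<Sum>i=1..p. M *v (E i *v v))"
      by (rule vec.linear_sum[OF matrix_vector_mul_linear_gen])
    also have "\<dots> = M *v v"
      by (simp add: eig) (simp add: M sum_matrix_vector_mult smult_matrix_vector_mult)
    finally have "M *v (v - ?w) = 0 *s (v - ?w)"
      by (simp add: matrix_vector_mult_diff_distrib)
    then have "v - ?w \<in> vec.span ?V" by (intro vec.span_base) blast
    moreover have "?w \<in> vec.span ?V"
      using eig by (intro vec.span_sum vec.span_base) blast
    ultimately have "(v - ?w) + ?w \<in> vec.span ?V" by (rule vec.span_add)
    then show ?thesis by simp
  qed
  then show "vec.span ?V = UNIV" by auto
qed

text \<open>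
  Conjugation by \<open>P\<close> preserves sums and products, so it suffices to split the diagonal matrix \<open>D\<close>
  into the 0-1 diagonal matrices that mark the positions of each of its nonzero values.
\<close>

lemma frobenius_system_if_diagonalizable:
  fixes M :: "'a::field^'n^'n"
  assumes "diagonalizable_matrix M" "M \<noteq> 0"
  obtains p l and E :: "nat \<Rightarrow> 'a^'n^'n"
  where "frobenius_system p E" "\<And>i. i \<in> {1..p} \<Longrightarrow> l i \<noteq> 0" "inj_on l {1..p}"
    "M = (\<Sum>i=1..p. smult_matrix (l i) (E i))"
proof -
  obtain P D :: "'a^'n^'n" where P: "invertible P" and D: "diagonal_matrix D"
    and M: "M = P ** D ** matrix_inv P"
    using assms(1) unfolding diagonalizable_matrix_def by (elim exE conjE) (rule that)
  define Q where "Q = matrix_inv P"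
  have QP: "Q ** P = mat 1" unfolding Q_def using P by (rule matrix_inv_inverse)
  define S where "S = {D $ k $ k |k. D $ k $ k \<noteq> 0}"
  have "finite S" unfolding S_def by (rule finite_subset[of _ "range (\<lambda>k. D $ k $ k)"]) auto
  then obtain l where l: "bij_betw l {1..card S} S" using ex_bij_betw_nat_finite_1 by blast
  have "S \<noteq> {}"
  proof
    assume "S = {}"
    then have "D $ i $ j = 0" for i j
      using D by (cases "i = j") (auto simp: S_def diagonal_matrix_def)
    then have "D = 0" by (simp add: vec_eq_iff)
    then show False using M assms(2) by simp
  qed
  then have p: "1 \<le> card S" using \<open>finite S\<close> by (simp add: card_gt_0_iff Suc_le_eq)
  define G :: "'a \<Rightarrow> 'a^'n^'n" where
    "G x = (\<chi> i j. if i = j \<and> D $ i $ i = x then 1 else 0)" for x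
  define E where "E i = P ** G (l i) ** Q" for i
  have GG: "G x ** G y = (if x = y then G x else 0)" for x y
  proof -
    have "(G x ** G y) $ i $ j = (if x = y then G x else 0) $ i $ j" for i j
    proof -
      have "(G x ** G y) $ i $ j = (\<Sum>k\<in>UNIV. if k = i then G x $ i $ i * G y $ i $ j else 0)"
        unfolding matrix_matrix_mult_def by (simp only: vec_lambda_beta, rule sum.cong) (auto simp: G_def)
      also have "\<dots> = G x $ i $ i * G y $ i $ j" by simp
      also have "\<dots> = (if x = y then G x else 0) $ i $ j" by (auto simp: G_def)
      finally show ?thesis .
    qed
    then show ?thesis by (simp add: vec_eq_iff)
  qed
  have Gnz: "G x \<noteq> 0" if "x \<in> S" for x
    using that by (auto simp: S_def G_def vec_eq_iff)
  have QGP: "Q ** (P ** B ** Q) ** P = B" for B :: "'a^'n^'n"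
  proof -
    have "Q ** (P ** B ** Q) ** P = (Q ** P) ** B ** (Q ** P)"
      by (simp only: matrix_mul_assoc)
    then show ?thesis by (simp add: QP)
  qed
  have conj: "(P ** B ** Q) ** (P ** C ** Q) = P ** (B ** C) ** Q" for B C :: "'a^'n^'n"
  proof -
    have "(P ** B ** Q) ** (P ** C ** Q) = P ** B ** (Q ** P) ** C ** Q"
      by (simp only: matrix_mul_assoc)
    then show ?thesis by (simp add: QP matrix_mul_assoc)
  qed
  have sys: "frobenius_system (card S) E"
    unfolding frobenius_system_def
  proof (intro conjI ballI)
    show "1 \<le> card S" by (rule p)
    show "E i \<noteq> 0" if "i \<in> {1..card S}" for i
    proof
      assume "E i = 0"
      then have "G (l i) = 0" using QGP[of "G (l i)"] by (simp add: E_def)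
      moreover have "l i \<in> S" using l that by (auto simp: bij_betw_def)
      ultimately show False using Gnz by simp
    qed
    show "E i ** E j = (if i = j then E i else 0)"
      if "i \<in> {1..card S}" "j \<in> {1..card S}" for i j
    proof -
      have "l i = l j \<longleftrightarrow> i = j" by (rule inj_on_eq_iff[OF bij_betw_imp_inj_on[OF l] that])
      then show ?thesis by (simp add: E_def conj GG)
    qed
  qed
  have "D = (\<Sum>x\<in>S. smult_matrix x (G x))"
  proof -
    have entry: "smult_matrix x (G x) $ i $ j = (if x = D $ i $ i then D $ i $ j else 0)" for x i j
      using D by (cases "i = j") (auto simp: smult_matrix_def G_def diagonal_matrix_def)
    have "(\<Sum>x\<in>S. smult_matrix x (G x)) $ i $ j = (\<Sum>x\<in>S. if x = D $ i $ i then D $ i $ j else 0)" for i j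
      by (simp only: sum_component entry)
    moreover have "(\<Sum>x\<in>S. if x = D $ i $ i then D $ i $ j else 0) = D $ i $ j" for i j
    proof (cases "D $ i $ i \<in> S")
      case True
      then show ?thesis using \<open>finite S\<close> by simp
    next
      case False
      then have "D $ i $ i = 0" unfolding S_def by blast
      then have "D $ i $ j = 0" using D by (cases "i = j") (auto simp: diagonal_matrix_def)
      then show ?thesis using False \<open>finite S\<close> by simp
    qed
    ultimately show ?thesis by (simp add: vec_eq_iff)
  qed
  also have "\<dots> = (\<Sum>i=1..card S. smult_matrix (l i) (G (l i)))"
    by (rule sum.reindex_bij_betw[OF l, symmetric])
  finally have "M = (\<Sum>i=1..card S. smult_matrix (l i) (E i))"
    by (simp add: M Q_def[symmetric] E_def sum_matrix_mult matrix_mult_sum_right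
        smult_matrix_mult_left smult_matrix_mult_right)
  moreover have "l i \<noteq> 0" if "i \<in> {1..card S}" for i
  proof -
    have "l i \<in> S" using l that by (rule bij_betwE[THEN bspec])
    then show ?thesis by (auto simp: S_def)
  qed
  moreover have "inj_on l {1..card S}" using l by (rule bij_betw_imp_inj_on)
  ultimately show thesis using sys by (intro that[of "card S" E l])
qed

section \<open>Uniqueness\<close>

text \<open>
  Let \<open>M\<close> be the common sum.  It acts on \<open>E i\<close> from the left and on \<open>F j\<close> from the right by a
  scalar, so \<open>F j ** E i\<close> vanishes unless the two scalars agree; expanding \<open>M ** E i\<close> and
  \<open>F j ** M\<close> then identifies both \<open>E i\<close> and \<open>F j\<close> with \<open>F j ** E i\<close>.
\<close>

lemma spectral_sums_match:
  fixes E F :: "nat \<Rightarrow> 'a::field^'n^'n"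
  assumes E: "frobenius_system p E" "\<And>i. i \<in> {1..p} \<Longrightarrow> l i \<noteq> 0" "inj_on l {1..p}"
    and F: "frobenius_system q F" "\<And>j. j \<in> {1..q} \<Longrightarrow> m j \<noteq> 0" "inj_on m {1..q}"
    and eq: "(\<Sum>i=1..p. smult_matrix (l i) (E i)) = (\<Sum>j=1..q. smult_matrix (m j) (F j))"
    and i: "i \<in> {1..p}"
  shows "\<exists>j\<in>{1..q}. m j = l i \<and> F j = E i"
proof -
  let ?M = "\<Sum>i=1..p. smult_matrix (l i) (E i)"
  have orth: "F j ** E k = 0" if "k \<in> {1..p}" "j \<in> {1..q}" "l k \<noteq> m j" for k j
  proof -
    have "F j ** (?M ** E k) = smult_matrix (l k) (F j ** E k)"
      by (simp add: spectral_sum_mult_idempotent[OF E(1) that(1)] smult_matrix_mult_right del: One_nat_def)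
    moreover have "F j ** ?M ** E k = smult_matrix (m j) (F j ** E k)"
      by (simp add: eq idempotent_mult_spectral_sum[OF F(1) that(2)] smult_matrix_mult_left del: One_nat_def)
    ultimately show ?thesis
      using smult_matrix_cancel_scalar that(3) by (metis matrix_mul_assoc)
  qed
  have ME: "smult_matrix (l i) (E i) = (\<Sum>j=1..q. smult_matrix (m j) (F j ** E i))"
    using spectral_sum_mult_idempotent[OF E(1) i, of l]
    by (simp add: eq sum_matrix_mult smult_matrix_mult_left del: One_nat_def)
  have "\<exists>j\<in>{1..q}. m j = l i"
  proof (rule ccontr)
    assume "\<not> ?thesis"
    then have "F j ** E i = 0" if "j \<in> {1..q}" for j using orth[OF i that] that by metis
    then have "smult_matrix (l i) (E i) = smult_matrix (l i) 0" using ME by simp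
    then have "E i = 0" using smult_matrix_cancel_matrix E(2)[OF i] by blast
    then show False using E(1) i by (auto simp: frobenius_system_def)
  qed
  then obtain j where j: "j \<in> {1..q}" "m j = l i" by blast
  have "smult_matrix (l i) (E i) = (\<Sum>k=1..q. if k = j then smult_matrix (l i) (F j ** E i) else 0)"
    unfolding ME
  proof (rule sum.cong[OF refl])
    fix k assume k: "k \<in> {1..q}"
    have "F k ** E i = 0" if "k \<noteq> j"
      using orth[OF i k] inj_onD[OF F(3) _ k j(1)] j(2) that by metis
    then show "smult_matrix (m k) (F k ** E i) = (if k = j then smult_matrix (l i) (F j ** E i) else 0)"
      using j(2) by simp
  qed
  then have "smult_matrix (l i) (E i) = smult_matrix (l i) (F j ** E i)" using j(1) by simp
  then have 1: "E i = F j ** E i" using smult_matrix_cancel_matrix E(2)[OF i] by blast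
  have "smult_matrix (m j) (F j) = (\<Sum>k=1..p. smult_matrix (l k) (F j ** E k))"
    using idempotent_mult_spectral_sum[OF F(1) j(1), of m]
    by (simp add: eq[symmetric] matrix_mult_sum_right smult_matrix_mult_right del: One_nat_def)
  also have "\<dots> = (\<Sum>k=1..p. if k = i then smult_matrix (m j) (F j ** E i) else 0)"
  proof (rule sum.cong[OF refl])
    fix k assume k: "k \<in> {1..p}"
    have "F j ** E k = 0" if "k \<noteq> i"
      using orth[OF k j(1)] inj_onD[OF E(3) _ k i] j(2) that by metis
    then show "smult_matrix (l k) (F j ** E k) = (if k = i then smult_matrix (m j) (F j ** E i) else 0)"
      using j(2) by simp
  qed
  finally have "smult_matrix (m j) (F j) = smult_matrix (m j) (F j ** E i)" using i by simp
  then have "F j = F j ** E i" using smult_matrix_cancel_matrix F(2)[OF j(1)] by blast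
  then show ?thesis using 1 j by auto
qed

lemma frobenius_decomposition_match:
  assumes "frobenius_decomposition A p l E" "frobenius_decomposition A q m F" "i \<in> {1..p}"
  shows "\<exists>j\<in>{1..q}. m j = l i \<and> F j = E i"
  using assms by (intro spectral_sums_match[of p E l q F m i]) (auto simp: frobenius_decomposition_def)

text \<open>
  Matching in both directions shows that the two scalar families have the same range, and as they
  are injective the two lengths agree.
\<close>

lemma frobenius_decomposition_unique:
  assumes "frobenius_decomposition A p l E" "frobenius_decomposition A q m F"
  shows "p = q \<and> (\<exists>\<sigma>. \<sigma> permutes {1..p} \<and> (\<forall>i\<in>{1..p}. m (\<sigma> i) = l i \<and> F (\<sigma> i) = E i))"
proof -
  have inj: "inj_on l {1..p}" "inj_on m {1..q}"
    using assms by (auto simp: frobenius_decomposition_def)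
  have "l ` {1..p} = m ` {1..q}"
    using frobenius_decomposition_match[OF assms] frobenius_decomposition_match[OF assms(2,1)]
    by (auto simp: image_iff) metis+
  then have pq: "p = q" using inj by (metis card_atLeastAtMost card_image diff_Suc_1)
  obtain s where s: "\<And>i. i \<in> {1..p} \<Longrightarrow> s i \<in> {1..q} \<and> m (s i) = l i \<and> F (s i) = E i"
    using frobenius_decomposition_match[OF assms] by metis
  \<comment> \<open>Outside \<open>{1..p}\<close> the matching \<open>s\<close> is arbitrary, whereas \<open>permutes\<close> demands the identity there.\<close>
  define \<sigma> where "\<sigma> i = (if i \<in> {1..p} then s i else i)" for i
  have "inj_on s {1..p}" by (rule inj_onI) (metis s inj(1) inj_onD)
  then have "inj_on \<sigma> {1..p}" by (rule inj_on_cong[THEN iffD1, rotated]) (simp add: \<sigma>_def)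
  moreover have "\<sigma> ` {1..p} \<subseteq> {1..p}" using s pq by (auto simp: \<sigma>_def)
  ultimately have "bij_betw \<sigma> {1..p} {1..p}" by (simp add: bij_betw_def endo_inj_surj)
  then have "\<sigma> permutes {1..p}" by (rule bij_imp_permutes) (auto simp: \<sigma>_def)
  then show ?thesis using pq s by (auto simp: \<sigma>_def intro!: exI[of _ \<sigma>])
qed

section \<open>Frobenius decompositions of semisimple matrices\<close>

lemma frobenius_decomposition_iff_semisimple:
  fixes A :: "'k::field^'n^'n"
  assumes "A \<noteq> 0"
  shows "(\<exists>p l E. frobenius_decomposition A p l E) \<longleftrightarrow> semisimple_matrix A"
proof
  assume "\<exists>p l E. frobenius_decomposition A p l E"
  then show "semisimple_matrix A"
    using spectral_sum_diagonalizable
    by (auto simp: frobenius_decomposition_def semisimple_matrix_def)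
next
  assume "semisimple_matrix A"
  then have "diagonalizable_matrix (map_matrix to_ac A)" by (simp add: semisimple_matrix_def)
  moreover have "map_matrix to_ac A \<noteq> 0" using assms by (simp add: vec_eq_iff)
  ultimately obtain p l E where "frobenius_system p E" "\<And>i. i \<in> {1..p} \<Longrightarrow> l i \<noteq> 0"
    "inj_on l {1..p}" "map_matrix to_ac A = (\<Sum>i=1..p. smult_matrix (l i) (E i))"
    by (rule frobenius_system_if_diagonalizable) blast
  then show "\<exists>p l E. frobenius_decomposition A p l E"
    unfolding frobenius_decomposition_def by blast
qed

lemma frobenius_covariants_unique:
  assumes "frobenius_covariants A C" "frobenius_covariants A C'"
  shows "C = C'"
proof -
  have sub: "S \<subseteq> T" if S: "frobenius_covariants A S" and T: "frobenius_covariants A T" for S T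
  proof
    fix B assume "B \<in> S"
    obtain p l E where E: "frobenius_decomposition A p l E" "S = E ` {1..p}"
      using S unfolding frobenius_covariants_def by blast
    obtain q m F where F: "frobenius_decomposition A q m F" "T = F ` {1..q}"
      using T unfolding frobenius_covariants_def by blast
    obtain i where i: "i \<in> {1..p}" "B = E i" using \<open>B \<in> S\<close> E(2) by blast
    then obtain j where "j \<in> {1..q}" "F j = E i"
      using frobenius_decomposition_match[OF E(1) F(1)] by blast
    then show "B \<in> T" using i(2) F(2) by (metis imageI)
  qed
  show ?thesis by (rule subset_antisym) (rule sub[OF assms] sub[OF assms(2,1)])+
qed

theorem proposition1p9:
  fixes A :: "'k::field^'n^'n"
  assumes "A \<noteq> 0"
  shows "((\<exists>p l E. frobenius_decomposition A p l E) \<longleftrightarrow> semisimple_matrix A) \<and>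
    (semisimple_matrix A \<longrightarrow>
      (\<forall>p l E q m F. frobenius_decomposition A p l E \<longrightarrow> frobenius_decomposition A q m F \<longrightarrow>
        p = q \<and> (\<exists>\<sigma>. \<sigma> permutes {1..p} \<and> (\<forall>i\<in>{1..p}. m (\<sigma> i) = l i \<and> F (\<sigma> i) = E i))) \<and>
      (\<exists>!C. frobenius_covariants A C))"
proof (intro conjI impI)
  show iff: "(\<exists>p l E. frobenius_decomposition A p l E) \<longleftrightarrow> semisimple_matrix A"
    using assms by (rule frobenius_decomposition_iff_semisimple)
  show "\<forall>p l E q m F. frobenius_decomposition A p l E \<longrightarrow> frobenius_decomposition A q m F \<longrightarrow>
      p = q \<and> (\<exists>\<sigma>. \<sigma> permutes {1..p} \<and> (\<forall>i\<in>{1..p}. m (\<sigma> i) = l i \<and> F (\<sigma> i) = E i))"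
    by (intro allI impI) (rule frobenius_decomposition_unique)
  assume "semisimple_matrix A"
  then have "\<exists>C. frobenius_covariants A C" using iff unfolding frobenius_covariants_def by blast
  then show "\<exists>!C. frobenius_covariants A C" using frobenius_covariants_unique by blast
qed

end
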